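(* Let $\{X_i: i\in \mathbb{N}\}$ be a collection of real Banach spaces, let $Y_i$ be a closed linear subspace of $X_i$ such that $(Y_i,CB(X_i))$ has the restricted center property for every $i\in \mathbb{N}$, and let $1\leq p < \infty$. Let $X=(\oplus_pX_i)_{i \in \mathbb{N}}$ and $Y=(\oplus_pY_i)_{i \in \mathbb{N}}$. Then $Z_{Y_i}$ is lower Hausdorff semi-continuous (respectively, upper Hausdorff semi-continuous) on $CB(X_i)$ for every $i\in \mathbb{N}$ if and only if $Z_Y$ is lower Hausdorff semi-continuous (respectively, upper Hausdorff semi-continuous) on $\mathcal{P}(X)$.
   Context: For a real Banach space $X$, $CL(X)$ and $CB(X)$ denote the sets of non-empty closed, respectively non-empty closed bounded, subsets of $X$; $B_X$ is the closed unit ball. For $x\in X$ and $F\in CB(X)$, $r(x,F)=\sup\{\|x-a\|: a\in F\}$. For $V\in CL(X)$, $rad_V(F)=\inf\{r(v,F): v\in V\}$ and $Z_V(F)=\{v\in V: r(v,F)=rad_V(F)\}$. For $\mathcal{F}\subseteq CB(X)$, $(V,\mathcal{F})$ has the restricted center property if $Z_V(G)\neq\emptyset$ for every $G\in\mathcal{F}$. $Z_V$ also denotes the restricted center map $F\mapsto Z_V(F)$. Families of sets carry the Hausdorff metric $\mathcal{H}(A,B)=\inf\{r>0: A\subseteq B+rB_X,\ B\subseteq A+rB_X\}$. A map $T$ from a metric space $(N,d)$ to $(CB(X),\mathcal{H})$ is: upper Hausdorff semi-continuous on $N$ if for every $a_0\in N$ and $\epsilon>0$ there exists $\delta>0$ such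 that $T(a)\subseteq T(a_0)+\epsilon B_X$ whenever $a\in N$ and $d(a,a_0)<\delta$; lower Hausdorff semi-continuous on $N$ if for every $a_0\in N$ and $\epsilon>0$ there exists $\delta>0$ such that $T(a_0)\subseteq T(a)+\epsilon B_X$ whenever $a\in N$ and $d(a,a_0)<\delta$. $(\oplus_p X_i)_{i\in\mathbb{N}}$ is the $\ell_p$-direct sum: all $x=(x_i)_{i\in\mathbb{N}}$ with $x_i\in X_i$ and $\|x\|=(\sum_{i}\|x_i\|^p)^{1/p}<\infty$; $Y=(\oplus_p Y_i)_{i\in\mathbb{N}}$ is regarded as a closed subspace of $X$. $\mathcal{P}(X)$ denotes the collection of all $F\in CB(X)$ of the form $F=\prod_{i\in\mathbb{N}}F_i$ (full Cartesian product, contained in $X$) with $F_i\in CB(X_i)$ for every $i$. *)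

theory Defs
  imports "HOL-Analysis.Analysis" "HOL-Library.Function_Algebras"
begin

text \<open>
  Pointwise vector space structure on functions; addition and zero come from
  \<^theory>\<open>HOL-Library.Function_Algebras\<close>.
\<close>

instantiation "fun" :: (type, real_vector) real_vector
begin

definition scaleR_fun :: "real \<Rightarrow> ('a \<Rightarrow> 'b) \<Rightarrow> 'a \<Rightarrow> 'b"
  where "scaleR_fun c f = (\<lambda>i. c *\<^sub>R f i)"

instance
  by standard (auto simp: scaleR_fun_def fun_eq_iff algebra_simps)

end

text \<open>
  A normed space is a pair \<open>(S, N)\<close>: a linear subspace \<open>S\<close> of an arbitrary real vector space
  (without topology) and a function \<open>N\<close> that is a norm on \<open>S\<close>. The values of \<open>N\<close> outside \<open>S\<close> are
  irrelevant. So the members of a family of spaces may carry unrelated norms, and the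
  \<open>\<ell>\<^sub>p\<close>-sum of such a family, for an arbitrary real \<open>p\<close>, is again such a pair.
\<close>

definition normed_space_on :: "'v::real_vector set \<Rightarrow> ('v \<Rightarrow> real) \<Rightarrow> bool"
  where "normed_space_on S N \<longleftrightarrow>
    subspace S \<and>
    (\<forall>x\<in>S. 0 \<le> N x \<and> (N x = 0 \<longleftrightarrow> x = 0)) \<and>
    (\<forall>c. \<forall>x\<in>S. N (c *\<^sub>R x) = \<bar>c\<bar> * N x) \<and>
    (\<forall>x\<in>S. \<forall>y\<in>S. N (x + y) \<le> N x + N y)"

text \<open>
  The value 0 off \<open>S\<close> is needed because the locale \<^locale>\<open>Metric_space\<close> demands non-negativity
  and symmetry of the distance on the whole type.
\<close>

definition norm_dist :: "'v::real_vector set \<Rightarrow> ('v \<Rightarrow> real) \<Rightarrow> 'v \<Rightarrow> 'v \<Rightarrow> real"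
  where "norm_dist S N x y = (if x \<in> S \<and> y \<in> S then N (x - y) else 0)"

lemma Metric_space_norm_dist:
  assumes "normed_space_on S N"
  shows "Metric_space S (norm_dist S N)"
proof
  have sub: "subspace S" and nonneg: "\<And>x. x \<in> S \<Longrightarrow> 0 \<le> N x"
    and zero: "\<And>x. x \<in> S \<Longrightarrow> N x = 0 \<longleftrightarrow> x = 0"
    and scale: "\<And>c x. x \<in> S \<Longrightarrow> N (c *\<^sub>R x) = \<bar>c\<bar> * N x"
    and tri: "\<And>x y. x \<in> S \<Longrightarrow> y \<in> S \<Longrightarrow> N (x + y) \<le> N x + N y"
    using assms by (auto simp: normed_space_on_def)
  have diff: "x - y \<in> S" if "x \<in> S" "y \<in> S" for x y
    using sub that by (rule subspace_diff)
  show "0 \<le> norm_dist S N x y" for x y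
    by (simp add: norm_dist_def nonneg diff)
  show "norm_dist S N x y = norm_dist S N y x" for x y
    using scale[of "x - y" "-1"] diff[of x y] by (simp add: norm_dist_def)
  show "norm_dist S N x y = 0 \<longleftrightarrow> x = y" if "x \<in> S" "y \<in> S" for x y
    using that by (simp add: norm_dist_def zero diff)
  show "norm_dist S N x z \<le> norm_dist S N x y + norm_dist S N y z"
    if "x \<in> S" "y \<in> S" "z \<in> S" for x y z
    using tri[of "x - y" "y - z"] that by (simp add: norm_dist_def diff)
qed

definition banach_space_on :: "'v::real_vector set \<Rightarrow> ('v \<Rightarrow> real) \<Rightarrow> bool"
  where "banach_space_on S N \<longleftrightarrow>
    normed_space_on S N \<and> Metric_space.mcomplete S (norm_dist S N)"

definition CL :: "'v::real_vector set \<Rightarrow> ('v \<Rightarrow> real) \<Rightarrow> 'v set set"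
  where "CL S N = {A. A \<noteq> {} \<and> closedin (Metric_space.mtopology S (norm_dist S N)) A}"

definition CB :: "'v::real_vector set \<Rightarrow> ('v \<Rightarrow> real) \<Rightarrow> 'v set set"
  where "CB S N = {A \<in> CL S N. Metric_space.mbounded S (norm_dist S N) A}"

text \<open>The set \<open>A + r B\<close>, where \<open>B\<close> is the closed unit ball of \<open>(S, N)\<close>.\<close>

definition thicken :: "'v::real_vector set \<Rightarrow> ('v \<Rightarrow> real) \<Rightarrow> real \<Rightarrow> 'v set \<Rightarrow> 'v set"
  where "thicken S N r A = {a + r *\<^sub>R u | a u. a \<in> A \<and> u \<in> S \<and> N u \<le> 1}"

definition hausdorff_metric ::
    "'v::real_vector set \<Rightarrow> ('v \<Rightarrow> real) \<Rightarrow> 'v set \<Rightarrow> 'v set \<Rightarrow> real"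
  where "hausdorff_metric S N A B =
    Inf {r. r > 0 \<and> A \<subseteq> thicken S N r B \<and> B \<subseteq> thicken S N r A}"

text \<open>
  In \<open>far_radius\<close>, \<open>restricted_radius\<close> and \<open>center_map\<close> the points and sets lie in the carrier of
  the space normed by \<open>N\<close>, so the carrier itself is not an argument.
\<close>

definition far_radius :: "('v::real_vector \<Rightarrow> real) \<Rightarrow> 'v \<Rightarrow> 'v set \<Rightarrow> real"
  where "far_radius N x F = (SUP a\<in>F. N (x - a))"

definition restricted_radius :: "('v::real_vector \<Rightarrow> real) \<Rightarrow> 'v set \<Rightarrow> 'v set \<Rightarrow> real"
  where "restricted_radius N V F = (INF v\<in>V. far_radius N v F)"

definition center_map :: "('v::real_vector \<Rightarrow> real) \<Rightarrow> 'v set \<Rightarrow> 'v set \<Rightarrow> 'v set"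
  where "center_map N V F = {v \<in> V. far_radius N v F = restricted_radius N V F}"

definition restricted_center_property ::
    "('v::real_vector \<Rightarrow> real) \<Rightarrow> 'v set \<Rightarrow> 'v set set \<Rightarrow> bool"
  where "restricted_center_property N V \<F> \<longleftrightarrow> (\<forall>G\<in>\<F>. center_map N V G \<noteq> {})"

text \<open>
  Semi-continuity of a map from the metric space \<open>(M, d)\<close> to \<open>CB S N\<close>; that the map takes values
  in \<open>CB S N\<close> is part of the definition.
\<close>

definition upper_hausdorff_semicontinuous ::
    "'v::real_vector set \<Rightarrow> ('v \<Rightarrow> real) \<Rightarrow> 'm set \<Rightarrow> ('m \<Rightarrow> 'm \<Rightarrow> real) \<Rightarrow> ('m \<Rightarrow> 'v set) \<Rightarrow> bool"
  where "upper_hausdorff_semicontinuous S N M d T \<longleftrightarrow>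
    T \<in> M \<rightarrow> CB S N \<and>
    (\<forall>a0\<in>M. \<forall>\<epsilon>>0. \<exists>\<delta>>0. \<forall>a\<in>M. d a a0 < \<delta> \<longrightarrow> T a \<subseteq> thicken S N \<epsilon> (T a0))"

definition lower_hausdorff_semicontinuous ::
    "'v::real_vector set \<Rightarrow> ('v \<Rightarrow> real) \<Rightarrow> 'm set \<Rightarrow> ('m \<Rightarrow> 'm \<Rightarrow> real) \<Rightarrow> ('m \<Rightarrow> 'v set) \<Rightarrow> bool"
  where "lower_hausdorff_semicontinuous S N M d T \<longleftrightarrow>
    T \<in> M \<rightarrow> CB S N \<and>
    (\<forall>a0\<in>M. \<forall>\<epsilon>>0. \<exists>\<delta>>0. \<forall>a\<in>M. d a a0 < \<delta> \<longrightarrow> T a0 \<subseteq> thicken S N \<epsilon> (T a))"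

definition lp_norm :: "real \<Rightarrow> (nat \<Rightarrow> 'a \<Rightarrow> real) \<Rightarrow> (nat \<Rightarrow> 'a) \<Rightarrow> real"
  where "lp_norm p N x = (\<Sum>i. N i (x i) powr p) powr (1 / p)"

definition lp_sum :: "real \<Rightarrow> (nat \<Rightarrow> 'a set) \<Rightarrow> (nat \<Rightarrow> 'a \<Rightarrow> real) \<Rightarrow> (nat \<Rightarrow> 'a) set"
  where "lp_sum p S N = {x. (\<forall>i. x i \<in> S i) \<and> summable (\<lambda>i. N i (x i) powr p)}"

definition product_sets ::
    "real \<Rightarrow> (nat \<Rightarrow> 'a::real_vector set) \<Rightarrow> (nat \<Rightarrow> 'a \<Rightarrow> real) \<Rightarrow> (nat \<Rightarrow> 'a) set set"
  where "product_sets p S N =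
    {F \<in> CB (lp_sum p S N) (lp_norm p N).
      \<exists>F'. (\<forall>i. F' i \<in> CB (S i) (N i)) \<and> F = (\<Pi> i\<in>UNIV. F' i)}"

end

theory Submission
  imports Defs
begin

text \<open>
  For a product set, \<open>r(x, \<Prod>\<^sub>i F\<^sub>i)\<^sup>p = \<Sum>\<^sub>i r(x\<^sub>i, F\<^sub>i)\<^sup>p\<close>, so the restricted centers of
  \<open>\<Prod>\<^sub>i F\<^sub>i\<close> are exactly the families of restricted centers of the \<open>F\<^sub>i\<close>; such a family is
  automatically \<open>p\<close>-summable because a center \<open>v\<close> of \<open>F\<^sub>i\<close> satisfies \<open>\<parallel>v\<parallel> \<le> 2 r(0, F\<^sub>i)\<close>.
  Given a product set \<open>F\<close> and \<open>\<epsilon> > 0\<close>, the tails of \<open>(r(0, F\<^sub>i))\<^sub>i\<close> are small beyond some \<open>n\<close>,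
  uniformly for product sets close to \<open>F\<close> in the Hausdorff metric. So the coordinates beyond \<open>n\<close> of
  all centers are negligible, and semi-continuity in the first \<open>n\<close> coordinates suffices.
  Conversely, \<open>A \<mapsto> A \<times> \<Prod>\<^sub>j\<^sub>\<noteq>\<^sub>i {0}\<close> embeds \<open>CB(X\<^sub>i)\<close> into the product sets without increasing
  distances, and 0 is a center of \<open>{0}\<close>.
\<close>

subsection \<open>Nonnegative sequences of bounded p-norm\<close>

text \<open>The bound is imposed on partial sums, so that summability is a consequence and
  Minkowski's inequality and suprema need only finite sums.\<close>

definition lp_le :: "real \<Rightarrow> (nat \<Rightarrow> real) \<Rightarrow> real \<Rightarrow> bool"
  where "lp_le p a C \<longleftrightarrow> 0 \<le> C \<and> (\<forall>i. 0 \<le> a i) \<and> (\<forall>n. (\<Sum>i<n. a i powr p) \<le> C powr p)"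

lemma lp_le_D:
  assumes "lp_le p a C"
  shows "0 \<le> C" "0 \<le> a i" "(\<Sum>i<n. a i powr p) \<le> C powr p"
  using assms by (auto simp: lp_le_def)

text \<open>Passage between partial sums and the series, wanted where a genuine infinite sum occurs:
  the norm of the direct sum, the tail estimate and the termwise comparison of centers.\<close>

lemma lp_le_iff_suminf:
  assumes p: "0 < p" and a: "\<And>i. 0 \<le> a i" and C: "0 \<le> C"
  shows "lp_le p a C \<longleftrightarrow> summable (\<lambda>i. a i powr p) \<and> (\<Sum>i. a i powr p) powr (1 / p) \<le> C"
proof
  assume lp: "lp_le p a C"
  have s: "summable (\<lambda>i. a i powr p)"
    by (rule summableI_nonneg_bounded[where x = "C powr p"]) (auto simp: lp_le_D(3)[OF lp])
  have "(\<Sum>i. a i powr p) \<le> C powr p"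
    using s lp_le_D(3)[OF lp] by (rule suminf_le_const)
  then have "(\<Sum>i. a i powr p) powr (1 / p) \<le> (C powr p) powr (1 / p)"
    using p by (intro powr_mono2) (auto intro: suminf_nonneg s)
  also have "\<dots> = C"
    using p C by (simp add: powr_powr)
  finally show "summable (\<lambda>i. a i powr p) \<and> (\<Sum>i. a i powr p) powr (1 / p) \<le> C"
    using s by blast
next
  assume *: "summable (\<lambda>i. a i powr p) \<and> (\<Sum>i. a i powr p) powr (1 / p) \<le> C"
  have nn: "0 \<le> (\<Sum>i. a i powr p)"
    using * by (auto intro: suminf_nonneg)
  have "(\<Sum>i<n. a i powr p) \<le> C powr p" for n
  proof -
    have "(\<Sum>i<n. a i powr p) \<le> (\<Sum>i. a i powr p)"
      using * by (intro sum_le_suminf) auto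
    also have "\<dots> = ((\<Sum>i. a i powr p) powr (1 / p)) powr p"
      using p nn by (simp add: powr_powr)
    also have "\<dots> \<le> C powr p"
      using p * by (intro powr_mono2) auto
    finally show ?thesis .
  qed
  then show "lp_le p a C"
    using a C by (simp add: lp_le_def)
qed

lemma lp_le_component:
  assumes p: "0 < p" and lp: "lp_le p a C"
  shows "a i \<le> C"
proof (rule ccontr)
  assume "\<not> a i \<le> C"
  then have "C powr p < a i powr p"
    using p lp_le_D(1)[OF lp] by (intro powr_less_mono2) auto
  also have "\<dots> \<le> (\<Sum>i<Suc i. a i powr p)"
    by (simp add: sum_nonneg)
  also have "\<dots> \<le> C powr p"
    using lp by (rule lp_le_D)
  finally show False by simp
qed

lemma lp_le_mono:
  assumes p: "0 < p" and lp: "lp_le p b B" and le: "\<And>i. 0 \<le> a i" "\<And>i. a i \<le> b i" and "B \<le> C"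
  shows "lp_le p a C"
  unfolding lp_le_def
proof (intro conjI allI)
  show "0 \<le> C" using lp_le_D(1)[OF lp] \<open>B \<le> C\<close> by simp
  show "0 \<le> a i" for i by (rule le)
  show "(\<Sum>i<n. a i powr p) \<le> C powr p" for n
  proof -
    have "(\<Sum>i<n. a i powr p) \<le> (\<Sum>i<n. b i powr p)"
      using p le by (intro sum_mono powr_mono2) auto
    also have "\<dots> \<le> B powr p" using lp by (rule lp_le_D)
    also have "\<dots> \<le> C powr p"
      using p lp_le_D(1)[OF lp] \<open>B \<le> C\<close> by (intro powr_mono2) auto
    finally show ?thesis .
  qed
qed

lemma lp_le_scale:
  assumes p: "0 < p" and lp: "lp_le p a A" and c: "0 \<le> c"
  shows "lp_le p (\<lambda>i. c * a i) (c * A)"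
  using lp_le_D[OF lp] c
  by (auto simp: lp_le_def powr_mult simp flip: sum_distrib_left intro!: mult_left_mono)

text \<open>Convexity of the \<open>p\<close>-th power on the closed half-line. If an argument
  vanishes, the claim reduces to \<open>c powr p <= c\<close> for \<open>c\<close> in [0, 1];
  otherwise both arguments are positive and \<open>powr_convex\<close> applies.\<close>

lemma convex_powr_le:
  fixes x y p :: real
  assumes "1 \<le> p" "0 \<le> x" "0 \<le> y" "0 < l" "l < 1"
  shows "((1 - l) * x + l * y) powr p \<le> (1 - l) * x powr p + l * y powr p"
proof (cases "x = 0 \<or> y = 0")
  case True
  have "c powr p \<le> c" if "0 \<le> c" "c \<le> 1" for c :: real
    using powr_le_one_le[of c p] that assms by (cases "c = 0") auto
  from this[of l] this[of "1 - l"] show ?thesis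
    using True assms by (auto simp: powr_mult intro!: mult_right_mono)
next
  case False
  then show ?thesis
    using convex_onD[OF powr_convex[OF assms(1)], of l x y] assms by auto
qed

text \<open>Minkowski's inequality. For positive \<open>A\<close> and \<open>B\<close>,
  \<open>(a i + b i) / (A + B)\<close> is the convex combination of \<open>a i / A\<close> and
  \<open>b i / B\<close> with weights \<open>A / (A + B)\<close> and \<open>B / (A + B)\<close>.
  Convexity of the \<open>p\<close>-th power then applies termwise, and both normalised sequences
  have power sums at most 1. A zero bound forces its sequence to vanish.\<close>

lemma lp_le_add:
  assumes p: "1 \<le> p" and a: "lp_le p a A" and b: "lp_le p b B"
  shows "lp_le p (\<lambda>i. a i + b i) (A + B)"
proof -
  have nn: "0 \<le> A" "0 \<le> B" "\<And>i. 0 \<le> a i" "\<And>i. 0 \<le> b i"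
    using lp_le_D a b by auto
  consider "A = 0" | "B = 0" | "0 < A" "0 < B" using nn by linarith
  then show ?thesis
  proof cases
    case 1
    then have "a i = 0" for i
      using lp_le_component[OF _ a, of i] p nn(3)[of i] by simp
    then show ?thesis using 1 b by simp
  next
    case 2
    then have "b i = 0" for i
      using lp_le_component[OF _ b, of i] p nn(4)[of i] by simp
    then show ?thesis using 2 a by simp
  next
    case 3
    define l where "l = B / (A + B)"
    have l: "0 < l" "l < 1" "1 - l = A / (A + B)"
      using 3 by (auto simp: l_def field_simps)
    have pt: "(a i + b i) powr p \<le>
        (A + B) powr p * ((1 - l) * (a i / A) powr p + l * (b i / B) powr p)" for i
    proof -
      have "a i + b i = (A + B) * ((1 - l) * (a i / A) + l * (b i / B))"
      proof -
        have "(A + B) * (1 - l) = A" "(A + B) * l = B"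
          unfolding l(3) using 3 by (auto simp: l_def)
        then have "(A + B) * ((1 - l) * (a i / A)) = A * (a i / A)"
          "(A + B) * (l * (b i / B)) = B * (b i / B)"
          by (metis mult.assoc)+
        then show ?thesis using 3 by (simp add: distrib_left)
      qed
      then have "(a i + b i) powr p = (A + B) powr p * ((1 - l) * (a i / A) + l * (b i / B)) powr p"
        using 3 l nn by (simp add: powr_mult)
      also have "\<dots> \<le> (A + B) powr p * ((1 - l) * (a i / A) powr p + l * (b i / B) powr p)"
        using 3 l nn p by (intro mult_left_mono convex_powr_le) auto
      finally show ?thesis .
    qed
    have unit: "(\<Sum>i<n. (c i / D) powr p) \<le> 1" if "lp_le p c D" "0 < D" for c D n
    proof -
      have "(\<Sum>i<n. (c i / D) powr p) = (\<Sum>i<n. c i powr p) / D powr p"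
        using that lp_le_D(2)[OF that(1)] by (simp add: powr_divide sum_divide_distrib)
      then show ?thesis
        using that lp_le_D(3)[OF that(1), of n] by simp
    qed
    have "(\<Sum>i<n. (a i + b i) powr p) \<le> (A + B) powr p" for n
    proof -
      have "(\<Sum>i<n. (a i + b i) powr p) \<le>
          (\<Sum>i<n. (A + B) powr p * ((1 - l) * (a i / A) powr p + l * (b i / B) powr p))"
        by (intro sum_mono pt)
      also have "\<dots> = (A + B) powr p *
          ((1 - l) * (\<Sum>i<n. (a i / A) powr p) + l * (\<Sum>i<n. (b i / B) powr p))"
        by (simp add: sum.distrib flip: sum_distrib_left)
      also have "\<dots> \<le> (A + B) powr p * ((1 - l) * 1 + l * 1)"
        using l unit[OF a] unit[OF b] 3 by (intro mult_left_mono add_mono) auto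
      finally show ?thesis by simp
    qed
    then show ?thesis using nn by (simp add: lp_le_def)
  qed
qed

lemma lp_le_single:
  assumes "0 \<le> c" "0 < p"
  shows "lp_le p (\<lambda>j. if j = i then c else 0) c"
proof -
  have "(\<Sum>j<n. (if j = i then c else 0) powr p) = (\<Sum>j<n. if j = i then c powr p else 0)" for n
    by (intro sum.cong) auto
  then show ?thesis using assms by (simp add: lp_le_def)
qed

text \<open>Bounds the first \<open>n\<close> coordinates of a difference of centers. Repeated use
  of Minkowski's inequality gives the crude factor \<open>n\<close>, which suffices because
  \<open>c\<close> is chosen after \<open>n\<close>.\<close>

lemma lp_le_constant_prefix:
  assumes p: "1 \<le> p" and c: "0 \<le> c"
  shows "lp_le p (\<lambda>i. if i < n then c else 0) (real n * c)"
proof (induction n)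
  case 0
  then show ?case using p by (simp add: lp_le_def)
next
  case (Suc n)
  have "lp_le p (\<lambda>i. (if i < n then c else 0) + (if i = n then c else 0)) (real n * c + c)"
    using p c by (intro lp_le_add Suc.IH lp_le_single) auto
  moreover have "(\<lambda>i. (if i < n then c else 0) + (if i = n then c else 0))
      = (\<lambda>i. if i < Suc n then c else 0)"
    by (auto simp: fun_eq_iff)
  ultimately show ?case by (simp add: algebra_simps)
qed

text \<open>The tails of a convergent series tend to 0. The head is overwritten by 0 instead of
  shifting indices, so that a tail can be added coordinatewise to other sequences.\<close>

lemma lp_le_tail:
  assumes p: "1 \<le> p" and lp: "lp_le p a A" and t: "0 < t"
  obtains n where "lp_le p (\<lambda>i. if i < n then 0 else a i) t"
proof -
  have s: "summable (\<lambda>i. a i powr p)"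
    using lp p lp_le_D[OF lp] by (subst (asm) lp_le_iff_suminf) auto
  obtain n where n: "norm (\<Sum>i. a (i + n) powr p) < t powr p"
    using suminf_exist_split[OF _ s, of "t powr p"] t by auto
  have "(\<Sum>i<m. (if i < n then 0 else a i) powr p) \<le> t powr p" for m
  proof -
    have "(\<Sum>i<m. (if i < n then 0 else a i) powr p)
        = (\<Sum>i\<in>{n..<m}. (if i < n then 0 else a i) powr p)"
      by (intro sum.mono_neutral_right) auto
    also have "\<dots> = (\<Sum>i\<in>{n..<m}. a i powr p)"
      by (intro sum.cong) auto
    \<comment> \<open>Enlarging the range by nonnegative terms makes it an exact shift of the first
      \<open>m\<close> indices.\<close>
    also have "\<dots> \<le> (\<Sum>i\<in>{0+n..<m+n}. a i powr p)"
      by (intro sum_mono2) auto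
    also have "\<dots> = (\<Sum>i<m. a (i + n) powr p)"
      by (subst sum.shift_bounds_nat_ivl) (simp add: lessThan_atLeast0)
    also have "\<dots> \<le> (\<Sum>i. a (i + n) powr p)"
      using s by (intro sum_le_suminf) (auto simp: summable_iff_shift[of "\<lambda>i. a i powr p"])
    finally show ?thesis using n by simp
  qed
  then show ?thesis
    using that[of n] t lp_le_D(2)[OF lp] by (simp add: lp_le_def)
qed

text \<open>The coordinates of a selection can be chosen independently, so all suprema can be
  approached by one sequence of selections. The bound holds along this sequence and passes to the
  limit in each finite partial sum.\<close>

lemma lp_le_Sup:
  fixes g :: "nat \<Rightarrow> 'b \<Rightarrow> real"
  assumes p: "1 \<le> p" and ne: "\<And>i. A i \<noteq> {}"
    and bdd: "\<And>i. bdd_above (g i ` A i)"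
    and le: "\<And>f. (\<And>i. f i \<in> A i) \<Longrightarrow> lp_le p (\<lambda>i. g i (f i)) C"
  shows "lp_le p (\<lambda>i. SUP a\<in>A i. g i a) C"
proof -
  define s where "s i = (SUP a\<in>A i. g i a)" for i
  have nonneg: "0 \<le> g i a" if "a \<in> A i" for i a
  proof -
    \<comment> \<open>The hypothesis speaks only of full selections, so a single point
      \<open>a\<close> is completed to one arbitrarily.\<close>
    define f where "f = (\<lambda>j. SOME b. b \<in> A j)(i := a)"
    have "f j \<in> A j" for j
      using that ne by (auto simp: f_def some_in_eq)
    from lp_le_D(2)[OF le[OF this], of i] show ?thesis by (simp add: f_def)
  qed
  have C: "0 \<le> C"
    using lp_le_D(1)[OF le[of "\<lambda>j. SOME b. b \<in> A j"]] ne by (auto simp: some_in_eq)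
  have s_ge: "g i a \<le> s i" if "a \<in> A i" for i a
    unfolding s_def using that bdd by (intro cSUP_upper)
  have "0 \<le> s i" for i
    using ne[of i] nonneg s_ge by (meson all_not_in_conv order_trans)
  \<comment> \<open>For each \<open>k\<close> this yields one selection that is within
    \<open>1 / Suc k\<close> of the supremum in every coordinate at once.\<close>
  have "\<exists>a\<in>A i. s i - 1 / Suc k < g i a" for i k
    using less_cSUP_iff[OF ne bdd, of "s i - 1 / Suc k" i] by (simp add: s_def)
  then obtain h where h: "\<And>i k. h i k \<in> A i" "\<And>i k. s i - 1 / Suc k < g i (h i k)"
    by metis
  have lim: "(\<lambda>k. g i (h i k)) \<longlonglongrightarrow> s i" for i
  proof (rule real_tendsto_sandwich)
    show "\<forall>\<^sub>F k in sequentially. s i - 1 / Suc k \<le> g i (h i k)"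
      using h by (auto intro!: always_eventually less_imp_le)
    show "\<forall>\<^sub>F k in sequentially. g i (h i k) \<le> s i"
      using s_ge h by (auto intro!: always_eventually)
    have "(\<lambda>k. s i - inverse (real (Suc k))) \<longlonglongrightarrow> s i - 0"
      by (intro tendsto_intros LIMSEQ_inverse_real_of_nat)
    then show "(\<lambda>k. s i - 1 / real (Suc k)) \<longlonglongrightarrow> s i"
      by (simp add: inverse_eq_divide)
  qed simp
  have "(\<Sum>i<n. s i powr p) \<le> C powr p" for n
  proof (rule LIMSEQ_le_const2)
    show "(\<lambda>k. \<Sum>i<n. g i (h i k) powr p) \<longlonglongrightarrow> (\<Sum>i<n. s i powr p)"
      using p nonneg h by (intro tendsto_sum tendsto_powr2 lim tendsto_const) (auto intro!: always_eventually)
    show "\<exists>N. \<forall>k\<ge>N. (\<Sum>i<n. g i (h i k) powr p) \<le> C powr p"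
      using lp_le_D(3)[OF le[of "\<lambda>i. h i _"]] h(1) by blast
  qed
  then show ?thesis
    using C \<open>\<And>i. 0 \<le> s i\<close> by (simp add: lp_le_def s_def)
qed

subsection \<open>Sets, radii and centers in a normed space\<close>

lemma normed_space_onD:
  assumes "normed_space_on S N"
  shows "subspace S" "0 \<in> S" "N 0 = 0"
    and "x \<in> S \<Longrightarrow> 0 \<le> N x" "x \<in> S \<Longrightarrow> N x = 0 \<longleftrightarrow> x = 0"
    and "x \<in> S \<Longrightarrow> N (c *\<^sub>R x) = \<bar>c\<bar> * N x"
    and "x \<in> S \<Longrightarrow> y \<in> S \<Longrightarrow> N (x + y) \<le> N x + N y"
    and "x \<in> S \<Longrightarrow> y \<in> S \<Longrightarrow> x - y \<in> S"
  using assms by (auto simp: normed_space_on_def subspace_0 subspace_diff)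

lemma norm_on_diff_commute:
  assumes "normed_space_on S N" "x \<in> S" "y \<in> S"
  shows "N (x - y) = N (y - x)"
  using normed_space_onD(6)[OF assms(1), of "x - y" "-1"] normed_space_onD(8)[OF assms] by simp

lemma norm_on_diff_triangle:
  assumes "normed_space_on S N" "x \<in> S" "y \<in> S" "z \<in> S"
  shows "N (x - z) \<le> N (x - y) + N (y - z)"
  using normed_space_onD(7)[OF assms(1), of "x - y" "y - z"] normed_space_onD(8)[OF assms(1)] assms
  by simp

lemma norm_on_diff_le:
  assumes "normed_space_on S N" "x \<in> S" "y \<in> S"
  shows "N (x - y) \<le> N x + N y"
  using norm_on_diff_triangle[OF assms(1,2) normed_space_onD(2)[OF assms(1)] assms(3)]
    norm_on_diff_commute[OF assms(1) normed_space_onD(2)[OF assms(1)] assms(3)] by simp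

text \<open>Replaces the topology by an epsilon condition: closedness says that each point of
  \<open>S\<close> outside \<open>A\<close> has a ball disjoint from \<open>A\<close>, and this is
  its contrapositive.\<close>

lemma CL_iff:
  assumes ns: "normed_space_on S N"
  shows "A \<in> CL S N \<longleftrightarrow>
    A \<noteq> {} \<and> A \<subseteq> S \<and> (\<forall>x\<in>S. (\<forall>e>0. \<exists>a\<in>A. N (x - a) < e) \<longrightarrow> x \<in> A)"
proof -
  interpret Metric_space S "norm_dist S N"
    using ns by (rule Metric_space_norm_dist)
  have "disjnt A (mball x r) \<longleftrightarrow> \<not> (\<exists>a\<in>A. N (x - a) < r)" if "A \<subseteq> S" "x \<in> S" for x r
    using that by (auto simp: disjnt_iff norm_dist_def subset_iff)
  then show ?thesis
    by (auto simp: CL_def closedin_metric) blast+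
qed

text \<open>Bounded diameter and bounded norm agree: distances to a fixed point \<open>a0\<close> of
  \<open>A\<close> control norms, and the triangle inequality through 0 gives the converse.\<close>

lemma CB_iff:
  assumes ns: "normed_space_on S N"
  shows "A \<in> CB S N \<longleftrightarrow> A \<in> CL S N \<and> (\<exists>B. \<forall>a\<in>A. N a \<le> B)"
proof (cases "A \<in> CL S N")
  case True
  interpret Metric_space S "norm_dist S N"
    using ns by (rule Metric_space_norm_dist)
  have A: "A \<subseteq> S" "A \<noteq> {}" using True by (auto simp: CL_iff[OF ns])
  then obtain a0 where a0: "a0 \<in> A" "a0 \<in> S" by auto
  have "mbounded A \<longleftrightarrow> (\<exists>B. \<forall>a\<in>A. N a \<le> B)"
  proof
    assume "mbounded A"
    then obtain B where B: "\<forall>x\<in>A. \<forall>y\<in>A. norm_dist S N x y \<le> B"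
      unfolding mbounded_alt by blast
    have "N a \<le> B + N a0" if "a \<in> A" for a
    proof -
      have "N a \<le> N (a - a0) + N a0"
        using norm_on_diff_triangle[OF ns, of a a0 0] normed_space_onD(2)[OF ns] that A a0 by auto
      moreover have "N (a - a0) \<le> B"
        using B that a0 A by (metis norm_dist_def subsetD)
      ultimately show ?thesis by simp
    qed
    then show "\<exists>B. \<forall>a\<in>A. N a \<le> B" by blast
  next
    assume "\<exists>B. \<forall>a\<in>A. N a \<le> B"
    then obtain B where B: "\<And>a. a \<in> A \<Longrightarrow> N a \<le> B" by blast
    have "norm_dist S N x y \<le> B + B" if "x \<in> A" "y \<in> A" for x y
      using norm_on_diff_le[OF ns, of x y] B[OF that(1)] B[OF that(2)] that A
      by (auto simp: norm_dist_def)
    then show "mbounded A"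
      unfolding mbounded_alt using A by blast
  qed
  then show ?thesis using True by (simp add: CB_def)
qed (simp add: CB_def)

lemma CB_I:
  assumes "normed_space_on S N" "A \<noteq> {}" "A \<subseteq> S" "\<And>a. a \<in> A \<Longrightarrow> N a \<le> B"
    and "\<And>x. x \<in> S \<Longrightarrow> (\<And>e. 0 < e \<Longrightarrow> \<exists>a\<in>A. N (x - a) < e) \<Longrightarrow> x \<in> A"
  shows "A \<in> CB S N"
  unfolding CB_iff[OF assms(1)] CL_iff[OF assms(1)] using assms(2-5) by blast

lemma CB_D:
  assumes "normed_space_on S N" "A \<in> CB S N"
  shows "A \<noteq> {}" "A \<subseteq> S"
    and "x \<in> S \<Longrightarrow> (\<And>e. 0 < e \<Longrightarrow> \<exists>a\<in>A. N (x - a) < e) \<Longrightarrow> x \<in> A"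
  using assms by (auto simp: CB_iff CL_iff)

lemma CB_bounded:
  assumes "normed_space_on S N" "A \<in> CB S N"
  obtains B where "\<And>a. a \<in> A \<Longrightarrow> N a \<le> B"
  using assms by (auto simp: CB_iff)

lemma CB_singleton_0:
  assumes ns: "normed_space_on S N"
  shows "{0} \<in> CB S N"
proof (rule CB_I[OF ns, where B = 0])
  show "x \<in> {0}" if "x \<in> S" "\<And>e. 0 < e \<Longrightarrow> \<exists>a\<in>{0}. N (x - a) < e" for x
  proof -
    have "N x < e" if "0 < e" for e using \<open>\<And>e. 0 < e \<Longrightarrow> \<exists>a\<in>{0}. N (x - a) < e\<close>[OF that] by simp
    then have "\<not> 0 < N x" by blast
    then show ?thesis
      using normed_space_onD(4,5)[OF ns, of x] that(1) by auto
  qed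
qed (use normed_space_onD(2,3)[OF ns] in auto)

section \<open>Thickenings and the Hausdorff metric\<close>

lemma mem_thicken_iff:
  assumes ns: "normed_space_on S N" and A: "A \<subseteq> S" and r: "0 < r"
  shows "x \<in> thicken S N r A \<longleftrightarrow> x \<in> S \<and> (\<exists>a\<in>A. N (x - a) \<le> r)"
proof
  assume "x \<in> thicken S N r A"
  then obtain a u where x: "x = a + r *\<^sub>R u" "a \<in> A" "u \<in> S" "N u \<le> 1"
    by (auto simp: thicken_def)
  have "x \<in> S"
    using x A normed_space_onD(1)[OF ns] by (auto intro!: subspace_add subspace_scale)
  moreover have "N (x - a) \<le> r"
    using x normed_space_onD(6)[OF ns, of u r] r by simp
  ultimately show "x \<in> S \<and> (\<exists>a\<in>A. N (x - a) \<le> r)" using x by blast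
next
  assume "x \<in> S \<and> (\<exists>a\<in>A. N (x - a) \<le> r)"
  then obtain a where a: "x \<in> S" "a \<in> A" "N (x - a) \<le> r" by blast
  define u where "u = (1 / r) *\<^sub>R (x - a)"
  have xa: "x - a \<in> S" using a A by (intro normed_space_onD(8)[OF ns]) auto
  then have "u \<in> S"
    using normed_space_onD(1)[OF ns] by (simp add: u_def subspace_scale)
  moreover have "N u \<le> 1"
    using normed_space_onD(6)[OF ns xa, of "1 / r"] a r by (simp add: u_def)
  moreover have "x = a + r *\<^sub>R u" using r by (simp add: u_def)
  ultimately show "x \<in> thicken S N r A"
    using a(2) by (auto simp: thicken_def)
qed

lemma subset_thicken_iff:
  assumes "normed_space_on S N" "A \<subseteq> S" "B \<subseteq> S" "0 < r"
  shows "A \<subseteq> thicken S N r B \<longleftrightarrow> (\<forall>a\<in>A. \<exists>b\<in>B. N (a - b) \<le> r)"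
  using assms by (auto simp: mem_thicken_iff subset_iff)

lemma hausdorff_metric_le:
  assumes ns: "normed_space_on S N" and S: "A \<subseteq> S" "B \<subseteq> S" and r: "0 < r"
    and "\<And>a. a \<in> A \<Longrightarrow> \<exists>b\<in>B. N (a - b) \<le> r" "\<And>b. b \<in> B \<Longrightarrow> \<exists>a\<in>A. N (b - a) \<le> r"
  shows "hausdorff_metric S N A B \<le> r"
  unfolding hausdorff_metric_def
proof (rule cInf_lower)
  show "r \<in> {r. 0 < r \<and> A \<subseteq> thicken S N r B \<and> B \<subseteq> thicken S N r A}"
    using assms by (simp add: subset_thicken_iff)
qed (auto intro!: bdd_belowI[where m = 0])

text \<open>An infimum below \<open>d\<close> gives an admissible radius below \<open>d\<close> only
  if some radius is admissible at all. Boundedness provides one: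
  \<open>\<bar>C\<bar> + \<bar>D\<bar> + 1\<close> exceeds every distance between the two sets, and
  the summand 1 makes it positive.\<close>

lemma hausdorff_metric_lessE:
  assumes ns: "normed_space_on S N" and A: "A \<in> CB S N" and B: "B \<in> CB S N"
    and less: "hausdorff_metric S N A B < d"
  obtains r where "0 < r" "r < d"
    "\<And>a. a \<in> A \<Longrightarrow> \<exists>b\<in>B. N (a - b) \<le> r" "\<And>b. b \<in> B \<Longrightarrow> \<exists>a\<in>A. N (b - a) \<le> r"
proof -
  note S = CB_D(2)[OF ns A] CB_D(2)[OF ns B]
  note ne = CB_D(1)[OF ns A] CB_D(1)[OF ns B]
  obtain C where C: "\<And>a. a \<in> A \<Longrightarrow> N a \<le> C" using CB_bounded[OF ns A] by blast
  obtain D where D: "\<And>b. b \<in> B \<Longrightarrow> N b \<le> D" using CB_bounded[OF ns B] by blast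
  define R where "R = {r. 0 < r \<and> A \<subseteq> thicken S N r B \<and> B \<subseteq> thicken S N r A}"
  have le: "N (a - b) \<le> \<bar>C\<bar> + \<bar>D\<bar> + 1" "N (b - a) \<le> \<bar>C\<bar> + \<bar>D\<bar> + 1" if "a \<in> A" "b \<in> B" for a b
    using norm_on_diff_le[OF ns, of a b] norm_on_diff_le[OF ns, of b a] C[OF that(1)] D[OF that(2)]
      that S by (auto simp: subset_iff)
  have pos: "0 < \<bar>C\<bar> + \<bar>D\<bar> + 1" by simp
  have "\<bar>C\<bar> + \<bar>D\<bar> + 1 \<in> R"
    unfolding R_def mem_Collect_eq subset_thicken_iff[OF ns S(1,2) pos]
      subset_thicken_iff[OF ns S(2,1) pos]
    using pos le ne by blast
  then obtain r where r: "r \<in> R" "r < d"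
    using cInf_lessD[of R d] less by (auto simp: hausdorff_metric_def R_def)
  then have "0 < r" by (simp add: R_def)
  moreover from this r(1) have "\<forall>a\<in>A. \<exists>b\<in>B. N (a - b) \<le> r" "\<forall>b\<in>B. \<exists>a\<in>A. N (b - a) \<le> r"
    by (auto simp add: R_def subset_thicken_iff[OF ns] S)
  ultimately show ?thesis using that r(2) by blast
qed

section \<open>Far radii and restricted centers\<close>

lemma bdd_above_far_radius:
  assumes ns: "normed_space_on S N" and F: "F \<in> CB S N" and x: "x \<in> S"
  shows "bdd_above ((\<lambda>a. N (x - a)) ` F)"
proof -
  obtain B where B: "\<And>a. a \<in> F \<Longrightarrow> N a \<le> B" using CB_bounded[OF ns F] by blast
  have "N (x - a) \<le> N x + B" if "a \<in> F" for a
    using norm_on_diff_le[OF ns x, of a] B[OF that] CB_D(2)[OF ns F] that by auto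
  then show ?thesis by (rule bdd_aboveI2)
qed

lemma le_far_radius:
  assumes "normed_space_on S N" "F \<in> CB S N" "x \<in> S" "a \<in> F"
  shows "N (x - a) \<le> far_radius N x F"
  unfolding far_radius_def using assms(4) bdd_above_far_radius[OF assms(1-3)] by (rule cSUP_upper)

lemma far_radius_le:
  assumes "normed_space_on S N" "F \<in> CB S N" "\<And>a. a \<in> F \<Longrightarrow> N (x - a) \<le> r"
  shows "far_radius N x F \<le> r"
  unfolding far_radius_def using CB_D(1)[OF assms(1,2)] assms(3) by (intro cSUP_least)

lemma far_radius_nonneg:
  assumes ns: "normed_space_on S N" and F: "F \<in> CB S N" and x: "x \<in> S"
  shows "0 \<le> far_radius N x F"
proof -
  obtain a where a: "a \<in> F" "a \<in> S" using CB_D(1,2)[OF ns F] by blast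
  then have "0 \<le> N (x - a)" using x ns by (metis normed_space_onD(4,8))
  then show ?thesis using le_far_radius[OF ns F x a(1)] by linarith
qed

lemma norm_le_far_radius_0:
  assumes ns: "normed_space_on S N" and F: "F \<in> CB S N" and a: "a \<in> F"
  shows "N a \<le> far_radius N 0 F"
proof -
  have S: "a \<in> S" "0 \<in> S" using CB_D(2)[OF ns F] a normed_space_onD(2)[OF ns] by auto
  show ?thesis
    using le_far_radius[OF ns F S(2) a] norm_on_diff_commute[OF ns S] by simp
qed

lemma far_radius_triangle:
  assumes ns: "normed_space_on S N" and F: "F \<in> CB S N" and x: "x \<in> S" and y: "y \<in> S"
  shows "far_radius N x F \<le> N (x - y) + far_radius N y F"
proof (rule far_radius_le[OF ns F])
  fix a assume a: "a \<in> F"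
  then have "N (x - a) \<le> N (x - y) + N (y - a)"
    using CB_D(2)[OF ns F] x y by (intro norm_on_diff_triangle[OF ns]) auto
  then show "N (x - a) \<le> N (x - y) + far_radius N y F"
    using le_far_radius[OF ns F y a] by linarith
qed

text \<open>Far radii are nonnegative, so the infimum is a true lower bound and attaining it means
  being minimal. Later arguments compare radii and never compute
  \<open>restricted_radius\<close>.\<close>

lemma mem_center_map_iff:
  assumes ns: "normed_space_on S N" and F: "F \<in> CB S N" and V: "V \<subseteq> S"
  shows "v \<in> center_map N V F \<longleftrightarrow> v \<in> V \<and> (\<forall>w\<in>V. far_radius N v F \<le> far_radius N w F)"
proof -
  have bdd: "bdd_below ((\<lambda>v. far_radius N v F) ` V)"
    using far_radius_nonneg[OF ns F] V by (intro bdd_belowI2[where m = 0]) auto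
  have "far_radius N v F = restricted_radius N V F \<longleftrightarrow> (\<forall>w\<in>V. far_radius N v F \<le> far_radius N w F)"
    if v: "v \<in> V"
  proof
    assume "far_radius N v F = restricted_radius N V F"
    then show "\<forall>w\<in>V. far_radius N v F \<le> far_radius N w F"
      unfolding restricted_radius_def using bdd by (metis cINF_lower)
  next
    assume "\<forall>w\<in>V. far_radius N v F \<le> far_radius N w F"
    then have "far_radius N v F \<le> restricted_radius N V F"
      unfolding restricted_radius_def using v by (intro cINF_greatest) auto
    moreover have "restricted_radius N V F \<le> far_radius N v F"
      unfolding restricted_radius_def using bdd v by (intro cINF_lower)
    ultimately show "far_radius N v F = restricted_radius N V F" by simp
  qed
  then show ?thesis by (auto simp: center_map_def)
qed

text \<open>The competitor 0 gives \<open>far_radius N v F <= far_radius N 0 F\<close>; the triangle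
  inequality through any point of \<open>F\<close> then accounts for the factor 2.\<close>

lemma center_norm_le:
  assumes ns: "normed_space_on S N" and F: "F \<in> CB S N" and V: "V \<subseteq> S" "0 \<in> V"
    and v: "v \<in> center_map N V F"
  shows "N v \<le> 2 * far_radius N 0 F"
proof -
  have v': "v \<in> S" "far_radius N v F \<le> far_radius N 0 F"
    using v V by (auto simp: mem_center_map_iff[OF ns F V(1)])
  obtain a where a: "a \<in> F" "a \<in> S" using CB_D(1,2)[OF ns F] by blast
  have "N v \<le> N (v - a) + N a"
    using norm_on_diff_triangle[OF ns v'(1) a(2) normed_space_onD(2)[OF ns]] by simp
  also have "\<dots> \<le> far_radius N v F + far_radius N 0 F"
    using le_far_radius[OF ns F v'(1) a(1)] norm_le_far_radius_0[OF ns F a(1)] by simp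
  finally show ?thesis using v'(2) by simp
qed

text \<open>Boundedness is \<open>center_norm_le\<close>. For closedness, the far radius is
  1-Lipschitz in its center, so minimality survives limits, and \<open>V\<close> itself is
  closed.\<close>

lemma center_map_CB:
  assumes ns: "normed_space_on S N" and F: "F \<in> CB S N" and V: "V \<in> CL S N" "0 \<in> V"
    and ne: "center_map N V F \<noteq> {}"
  shows "center_map N V F \<in> CB S N"
proof (rule CB_I[OF ns ne, where B = "2 * far_radius N 0 F"])
  have VS: "V \<subseteq> S" using V by (simp add: CL_iff[OF ns])
  show "center_map N V F \<subseteq> S" using VS by (auto simp: center_map_def)
  show "N a \<le> 2 * far_radius N 0 F" if "a \<in> center_map N V F" for a
    using center_norm_le[OF ns F VS V(2) that] .
  fix x assume x: "x \<in> S" and lim: "\<And>e. 0 < e \<Longrightarrow> \<exists>a\<in>center_map N V F. N (x - a) < e"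
  have "\<exists>a\<in>V. N (x - a) < e" if "0 < e" for e
    using lim[OF that] by (auto simp: center_map_def)
  then have "x \<in> V"
    using V(1) x by (simp add: CL_iff[OF ns])
  moreover have "far_radius N x F \<le> far_radius N w F" if w: "w \<in> V" for w
  proof (rule field_le_epsilon)
    fix e :: real assume "0 < e"
    then obtain a where a: "a \<in> center_map N V F" "N (x - a) < e" using lim by blast
    have "far_radius N x F \<le> N (x - a) + far_radius N a F"
      using a(1) VS by (intro far_radius_triangle[OF ns F x]) (auto simp: center_map_def)
    moreover have "far_radius N a F \<le> far_radius N w F"
      using a(1) w by (simp add: mem_center_map_iff[OF ns F VS])
    ultimately show "far_radius N x F \<le> far_radius N w F + e" using a(2) by linarith
  qed
  ultimately show "x \<in> center_map N V F"
    by (simp add: mem_center_map_iff[OF ns F VS])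
qed

text \<open>Allows a center in one coordinate to be extended by zeros to a center of an embedded
  set.\<close>

lemma center_map_singleton_0:
  assumes ns: "normed_space_on S N" and V: "V \<subseteq> S" "0 \<in> V"
  shows "0 \<in> center_map N V {0}"
  using normed_space_onD(2-4)[OF ns] V
  by (auto simp: mem_center_map_iff[OF ns CB_singleton_0[OF ns] V(1)] far_radius_def)

subsection \<open>The direct sum of a family\<close>

locale normed_family =
  fixes X :: "nat \<Rightarrow> 'a::real_vector set" and N :: "nat \<Rightarrow> 'a \<Rightarrow> real" and p :: real
  assumes normed: "\<And>i. normed_space_on (X i) (N i)" and p: "1 \<le> p"
begin

abbreviation "XX \<equiv> lp_sum p X N"
abbreviation "NN \<equiv> lp_norm p N"

text \<open>Couples membership in the sum with the norm bound, because the value of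
  \<open>lp_norm\<close> carries no information when the series diverges.\<close>

lemma lp_le_norm_iff:
  assumes "\<And>i. x i \<in> X i"
  shows "lp_le p (\<lambda>i. N i (x i)) C \<longleftrightarrow> 0 \<le> C \<and> x \<in> XX \<and> NN x \<le> C"
proof (cases "0 \<le> C")
  case True
  have "0 \<le> N i (x i)" for i using assms normed_space_onD(4)[OF normed] by blast
  then show ?thesis
    using p True assms by (subst lp_le_iff_suminf) (auto simp: lp_sum_def lp_norm_def)
qed (auto dest: lp_le_D)

lemma lp_norm_nonneg: "0 \<le> NN x"
  by (simp add: lp_norm_def)

lemma lp_le_norm: "x \<in> XX \<Longrightarrow> lp_le p (\<lambda>i. N i (x i)) (NN x)"
  by (subst lp_le_norm_iff) (auto simp: lp_sum_def lp_norm_nonneg)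

lemma lp_sum_component: "x \<in> XX \<Longrightarrow> x i \<in> X i"
  by (simp add: lp_sum_def)

lemma norm_component_le: "x \<in> XX \<Longrightarrow> N i (x i) \<le> NN x"
  using lp_le_component[OF _ lp_le_norm] p by simp

lemma lp_sum_add:
  assumes "x \<in> XX" "y \<in> XX"
  shows "x + y \<in> XX \<and> NN (x + y) \<le> NN x + NN y"
proof -
  note X = lp_sum_component[OF assms(1)] lp_sum_component[OF assms(2)]
  have XY: "(x + y) i \<in> X i" for i
    using X normed_space_onD(1)[OF normed] by (auto intro: subspace_add)
  have "lp_le p (\<lambda>i. N i ((x + y) i)) (NN x + NN y)"
  proof (rule lp_le_mono[OF _ lp_le_add[OF p lp_le_norm lp_le_norm]])
    show "N i ((x + y) i) \<le> N i (x i) + N i (y i)" for i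
      using X by (simp add: normed_space_onD(7)[OF normed])
    show "0 \<le> N i ((x + y) i)" for i by (rule normed_space_onD(4)[OF normed XY])
  qed (use p assms in auto)
  then show ?thesis using lp_le_norm_iff[OF XY] by blast
qed

lemma lp_sum_scale:
  assumes "x \<in> XX"
  shows "c *\<^sub>R x \<in> XX \<and> NN (c *\<^sub>R x) = \<bar>c\<bar> * NN x"
proof -
  have nn: "0 \<le> N i (x i)" for i
    using lp_sum_component[OF assms] normed_space_onD(4)[OF normed] by blast
  have s: "summable (\<lambda>i. N i (x i) powr p)" using assms by (simp add: lp_sum_def)
  have eq: "N i ((c *\<^sub>R x) i) powr p = \<bar>c\<bar> powr p * N i (x i) powr p" for i
    using nn by (simp add: scaleR_fun_def normed_space_onD(6)[OF normed lp_sum_component[OF assms]]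
        powr_mult)
  have "c *\<^sub>R x \<in> XX"
    unfolding lp_sum_def mem_Collect_eq eq
    using s lp_sum_component[OF assms] normed_space_onD(1)[OF normed]
    by (auto simp: scaleR_fun_def intro: subspace_scale)
  moreover have "NN (c *\<^sub>R x) = \<bar>c\<bar> * NN x"
    using p s suminf_nonneg[OF s] by (simp add: lp_norm_def eq suminf_mult powr_mult powr_powr)
  ultimately show ?thesis by simp
qed

lemma normed_space_lp_sum: "normed_space_on XX NN"
proof -
  have z: "0 \<in> XX" "NN 0 = 0"
    using normed_space_onD(2,3)[OF normed] p by (auto simp: lp_sum_def lp_norm_def)
  have "subspace XX"
    using z lp_sum_add lp_sum_scale by (auto intro!: subspaceI)
  moreover have "x = 0" if "x \<in> XX" "NN x = 0" for x
  proof
    fix i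
    have "N i (x i) \<le> 0" using norm_component_le[OF that(1), of i] that by simp
    then show "x i = 0 i"
      using normed_space_onD(4,5)[OF normed lp_sum_component[OF that(1), of i]] by auto
  qed
  ultimately show ?thesis
    unfolding normed_space_on_def using z lp_norm_nonneg lp_sum_scale lp_sum_add by blast
qed

text \<open>A \<open>p\<close>-summable bound on the factors puts every selection into the direct
  sum. Closedness is checked coordinatewise, since coordinate projections do not increase
  norms.\<close>

lemma product_CB:
  assumes A: "\<And>i. A i \<in> CB (X i) (N i)" and b: "\<And>i a. a \<in> A i \<Longrightarrow> N i a \<le> b i"
    and B: "lp_le p b B"
  shows "Pi UNIV A \<in> CB XX NN"
proof (rule CB_I[OF normed_space_lp_sum, where B = B])
  have fX: "f i \<in> X i" if "f \<in> Pi UNIV A" for f i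
    using that CB_D(2)[OF normed A] by (auto simp: Pi_iff)
  have "lp_le p (\<lambda>i. N i (f i)) B" if "f \<in> Pi UNIV A" for f
  proof (rule lp_le_mono[OF _ B])
    show "0 \<le> N i (f i)" "N i (f i) \<le> b i" for i
      using that b normed_space_onD(4)[OF normed fX[OF that]] by (auto simp: Pi_iff)
  qed (use p in auto)
  then have mem: "f \<in> XX \<and> NN f \<le> B" if "f \<in> Pi UNIV A" for f
    using lp_le_norm_iff[OF fX[OF that]] that by blast
  then show "Pi UNIV A \<subseteq> XX" "\<And>a. a \<in> Pi UNIV A \<Longrightarrow> NN a \<le> B" by auto
  show "Pi UNIV A \<noteq> {}"
    using CB_D(1)[OF normed A] by (simp add: Pi_eq_empty)
  fix x assume x: "x \<in> XX" and lim: "\<And>e. 0 < e \<Longrightarrow> \<exists>a\<in>Pi UNIV A. NN (x - a) < e"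
  have "x i \<in> A i" for i
  proof (rule CB_D(3)[OF normed A lp_sum_component[OF x]])
    fix e :: real assume "0 < e"
    then obtain a where a: "a \<in> Pi UNIV A" "NN (x - a) < e" using lim by blast
    have "x - a \<in> XX" using a x mem normed_space_onD(8)[OF normed_space_lp_sum] by blast
    from norm_component_le[OF this, of i] a show "\<exists>a\<in>A i. N i (x i - a) < e"
      by (intro bexI[of _ "a i"]) (auto simp: Pi_iff)
  qed
  then show "x \<in> Pi UNIV A" by auto
qed

text \<open>This is the identity \<open>r(x, \<Prod>\<^sub>i F\<^sub>i)\<^sup>p = \<Sum>\<^sub>i r(x\<^sub>i, F\<^sub>i)\<^sup>p\<close>.\<close>

lemma far_radius_product_le_iff:
  assumes F: "\<And>i. F i \<in> CB (X i) (N i)" and PF: "Pi UNIV F \<in> CB XX NN" and x: "x \<in> XX"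
  shows "lp_le p (\<lambda>i. far_radius (N i) (x i) (F i)) C \<longleftrightarrow> 0 \<le> C \<and> far_radius NN x (Pi UNIV F) \<le> C"
proof
  note xX = lp_sum_component[OF x]
  have diff: "x - f \<in> XX" if "f \<in> Pi UNIV F" for f
    using that x CB_D(2)[OF normed_space_lp_sum PF] normed_space_onD(8)[OF normed_space_lp_sum]
    by blast
  { assume lp: "lp_le p (\<lambda>i. far_radius (N i) (x i) (F i)) C"
    have "far_radius NN x (Pi UNIV F) \<le> C"
    proof (rule far_radius_le[OF normed_space_lp_sum PF])
      fix f assume f: "f \<in> Pi UNIV F"
      have "lp_le p (\<lambda>i. N i ((x - f) i)) C"
      proof (rule lp_le_mono[OF _ lp])
        show "0 \<le> N i ((x - f) i)" for i
          by (rule normed_space_onD(4)[OF normed lp_sum_component[OF diff[OF f]]])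
        show "N i ((x - f) i) \<le> far_radius (N i) (x i) (F i)" for i
          using le_far_radius[OF normed F xX] f by (auto simp: Pi_iff)
      qed (use p in auto)
      then show "NN (x - f) \<le> C"
        using lp_le_norm_iff[OF lp_sum_component[OF diff[OF f]]] by blast
    qed
    then show "0 \<le> C \<and> far_radius NN x (Pi UNIV F) \<le> C" using lp_le_D(1)[OF lp] by simp }
  { assume C: "0 \<le> C \<and> far_radius NN x (Pi UNIV F) \<le> C"
    show "lp_le p (\<lambda>i. far_radius (N i) (x i) (F i)) C"
      unfolding far_radius_def
    \<comment> \<open>Each selection from the factors is itself a point of the product, so the
      radius of the product bounds the \<open>p\<close>-norm of its coordinate distances.\<close>
    proof (rule lp_le_Sup[OF p])
      show "F i \<noteq> {}" for i by (rule CB_D(1)[OF normed F])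
      show "bdd_above ((\<lambda>a. N i (x i - a)) ` F i)" for i
        by (rule bdd_above_far_radius[OF normed F xX])
      fix f assume "\<And>i. f i \<in> F i"
      then have f: "f \<in> Pi UNIV F" by auto
      have "NN (x - f) \<le> C"
        using le_far_radius[OF normed_space_lp_sum PF x f] C by simp
      then have "lp_le p (\<lambda>i. N i ((x - f) i)) C"
        using lp_le_norm_iff[OF lp_sum_component[OF diff[OF f]]] C diff[OF f] by blast
      then show "lp_le p (\<lambda>i. N i (x i - f i)) C" by simp
    qed }
qed

lemma lp_le_far_radius:
  assumes F: "\<And>i. F i \<in> CB (X i) (N i)" and PF: "Pi UNIV F \<in> CB XX NN" and x: "x \<in> XX"
  shows "lp_le p (\<lambda>i. far_radius (N i) (x i) (F i)) (far_radius NN x (Pi UNIV F))"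
  using far_radius_nonneg[OF normed_space_lp_sum PF x] by (simp add: far_radius_product_le_iff assms)

lemma lp_le_far_radius_0:
  assumes F: "\<And>i. F i \<in> CB (X i) (N i)" and PF: "Pi UNIV F \<in> CB XX NN"
  shows "lp_le p (\<lambda>i. far_radius (N i) 0 (F i)) (far_radius NN 0 (Pi UNIV F))"
  using lp_le_far_radius[OF F PF normed_space_onD(2)[OF normed_space_lp_sum]] by simp

text \<open>A point of one factor is completed to a point of the product, approximated there, and
  projected back without increasing the distance.\<close>

lemma hausdorff_metric_component_less:
  assumes F: "\<And>i. F i \<in> CB (X i) (N i)" "Pi UNIV F \<in> CB XX NN"
    and G: "\<And>i. G i \<in> CB (X i) (N i)" "Pi UNIV G \<in> CB XX NN"
    and less: "hausdorff_metric XX NN (Pi UNIV F) (Pi UNIV G) < d"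
  shows "hausdorff_metric (X i) (N i) (F i) (G i) < d"
proof -
  obtain r where r: "0 < r" "r < d"
    "\<And>f. f \<in> Pi UNIV F \<Longrightarrow> \<exists>g\<in>Pi UNIV G. NN (f - g) \<le> r"
    "\<And>g. g \<in> Pi UNIV G \<Longrightarrow> \<exists>f\<in>Pi UNIV F. NN (g - f) \<le> r"
    using hausdorff_metric_lessE[OF normed_space_lp_sum F(2) G(2) less] by metis
  have *: "\<exists>b\<in>B i. N i (a - b) \<le> r"
    if a: "a \<in> A i" and A: "Pi UNIV A \<in> CB XX NN" and B: "Pi UNIV B \<in> CB XX NN"
      and AB: "\<And>f. f \<in> Pi UNIV A \<Longrightarrow> \<exists>g\<in>Pi UNIV B. NN (f - g) \<le> r" for a A B
  proof -
    obtain f where f: "f \<in> Pi UNIV A" using CB_D(1)[OF normed_space_lp_sum A] by blast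
    define f' where "f' = f(i := a)"
    have f': "f' \<in> Pi UNIV A" using f a by (auto simp: f'_def Pi_iff)
    then obtain g where g: "g \<in> Pi UNIV B" "NN (f' - g) \<le> r" using AB by blast
    have "f' - g \<in> XX"
      using f' g CB_D(2)[OF normed_space_lp_sum A] CB_D(2)[OF normed_space_lp_sum B]
      by (intro normed_space_onD(8)[OF normed_space_lp_sum]) auto
    from norm_component_le[OF this, of i] have "N i (a - g i) \<le> r"
      using g by (simp add: f'_def)
    then show ?thesis using g(1) by (auto simp: Pi_iff)
  qed
  have "hausdorff_metric (X i) (N i) (F i) (G i) \<le> r"
    using *[of _ F G] *[of _ G F] F G r
    by (intro hausdorff_metric_le normed r(1) CB_D(2)[OF normed]) blast+
  then show ?thesis using r(2) by simp
qed

text \<open>This makes the tails uniformly small near \<open>G\<close>. Every selection from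
  \<open>F\<close> has a point of \<open>G\<close> within distance less than \<open>d\<close>, so
  Minkowski's inequality bounds its tail by \<open>t + d\<close>; then the supremum is taken over
  all selections.\<close>

lemma tail_far_radius_le:
  assumes F: "\<And>i. F i \<in> CB (X i) (N i)" "Pi UNIV F \<in> CB XX NN"
    and G: "\<And>i. G i \<in> CB (X i) (N i)" "Pi UNIV G \<in> CB XX NN"
    and less: "hausdorff_metric XX NN (Pi UNIV F) (Pi UNIV G) < d"
    and tail: "lp_le p (\<lambda>i. if i < n then 0 else far_radius (N i) 0 (G i)) t"
  shows "lp_le p (\<lambda>i. if i < n then 0 else far_radius (N i) 0 (F i)) (t + d)"
proof -
  obtain r where r: "0 < r" "r < d"
    "\<And>f. f \<in> Pi UNIV F \<Longrightarrow> \<exists>g\<in>Pi UNIV G. NN (f - g) \<le> r"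
    using hausdorff_metric_lessE[OF normed_space_lp_sum F(2) G(2) less] by metis
  have zero: "0 \<in> X i" for i by (rule normed_space_onD(2)[OF normed])
  have "lp_le p (\<lambda>i. SUP a\<in>F i. if i < n then 0 else N i (0 - a)) (t + d)"
  proof (rule lp_le_Sup[OF p])
    show "F i \<noteq> {}" for i by (rule CB_D(1)[OF normed F(1)])
    show "bdd_above ((\<lambda>a. if i < n then 0 else N i (0 - a)) ` F i)" for i
      using bdd_above_far_radius[OF normed F(1) zero, of i] by auto
    fix f assume f: "\<And>i. f i \<in> F i"
    then obtain g where g: "g \<in> Pi UNIV G" "NN (f - g) \<le> r" using r(3)[of f] by auto
    have fX: "f i \<in> X i" and gX: "g i \<in> X i" for i
      using f g CB_D(2)[OF normed F(1)] CB_D(2)[OF normed G(1)] by (auto simp: Pi_iff subset_iff)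
    have "f - g \<in> XX"
      using f g CB_D(2)[OF normed_space_lp_sum F(2)] CB_D(2)[OF normed_space_lp_sum G(2)]
      by (intro normed_space_onD(8)[OF normed_space_lp_sum]) auto
    then have fg: "lp_le p (\<lambda>i. N i ((f - g) i)) (NN (f - g))" by (rule lp_le_norm)
    show "lp_le p (\<lambda>i. if i < n then 0 else N i (0 - f i)) (t + d)"
    proof (rule lp_le_mono[OF _ lp_le_add[OF p tail fg]])
      fix i
      show "0 \<le> (if i < n then 0 else N i (0 - f i))"
        using normed_space_onD(4)[OF normed normed_space_onD(8)[OF normed zero fX]] by simp
      have "N i (0 - f i) \<le> far_radius (N i) 0 (G i) + N i ((f - g) i)"
        using norm_on_diff_triangle[OF normed zero gX fX, of i] norm_on_diff_commute[OF normed gX fX, of i]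
          le_far_radius[OF normed G(1) zero, of "g i" i] g(1) by (auto simp: Pi_iff)
      then show "(if i < n then 0 else N i (0 - f i))
          \<le> (if i < n then 0 else far_radius (N i) 0 (G i)) + N i ((f - g) i)"
        using lp_le_D(2)[OF fg, of i] by auto
    qed (use p g r in auto)
  qed
  moreover have "(SUP a\<in>F i. if i < n then 0 else N i (0 - a))
      = (if i < n then 0 else far_radius (N i) 0 (F i))" for i
    using CB_D(1)[OF normed F(1), of i] by (auto simp: far_radius_def)
  ultimately show ?thesis by simp
qed

text \<open>The head of the difference is at most \<open>e\<close> in each coordinate, and its tail
  is bounded by the norms of \<open>u\<close> and \<open>w\<close>. The factor 2 is the one from
  \<open>center_norm_le\<close>, with \<open>s\<close> and \<open>t\<close> standing for radii about
  0.\<close>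

lemma norm_diff_le_head_tail:
  assumes X: "\<And>i. u i \<in> X i" "\<And>i. w i \<in> X i"
    and near: "\<And>i. i < n \<Longrightarrow> N i (u i - w i) \<le> e" and e: "0 \<le> e"
    and u: "\<And>i. N i (u i) \<le> 2 * s i" "lp_le p (\<lambda>i. if i < n then 0 else s i) S"
    and w: "\<And>i. N i (w i) \<le> 2 * t i" "lp_le p (\<lambda>i. if i < n then 0 else t i) T"
  shows "NN (u - w) \<le> real n * e + 2 * S + 2 * T"
proof -
  have XX: "(u - w) i \<in> X i" for i
    using X normed_space_onD(8)[OF normed] by simp
  have "lp_le p (\<lambda>i. N i ((u - w) i)) (real n * e + 2 * S + 2 * T)"
  proof (rule lp_le_mono[OF _ lp_le_add[OF p lp_le_add[OF p lp_le_constant_prefix[OF p e]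
            lp_le_scale[where c = 2, OF _ u(2)]] lp_le_scale[where c = 2, OF _ w(2)]]])
    show "0 \<le> N i ((u - w) i)" for i by (rule normed_space_onD(4)[OF normed XX])
    show "N i ((u - w) i) \<le> (if i < n then e else 0) + 2 * (if i < n then 0 else s i)
        + 2 * (if i < n then 0 else t i)" for i
      using near[of i] norm_on_diff_le[OF normed X(1) X(2), of i] u(1)[of i] w(1)[of i] by auto
  qed (use p in auto)
  then show ?thesis using lp_le_norm_iff[OF XX] by blast
qed

end

text \<open>Treats both kinds of semi-continuity at once; \<open>up\<close> selects which of the two sets is thickened.\<close>

definition directed_semicontinuous :: "bool \<Rightarrow> 'v::real_vector set \<Rightarrow> ('v \<Rightarrow> real) \<Rightarrow>
    'm set \<Rightarrow> ('m \<Rightarrow> 'm \<Rightarrow> real) \<Rightarrow> ('m \<Rightarrow> 'v set) \<Rightarrow> bool"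
  where "directed_semicontinuous up S N M d T \<longleftrightarrow>
    T \<in> M \<rightarrow> CB S N \<and>
    (\<forall>a0\<in>M. \<forall>\<epsilon>>0. \<exists>\<delta>>0. \<forall>a\<in>M. d a a0 < \<delta> \<longrightarrow>
      (if up then T a else T a0) \<subseteq> thicken S N \<epsilon> (if up then T a0 else T a))"

lemma directed_semicontinuous_simps:
  "directed_semicontinuous True = upper_hausdorff_semicontinuous"
  "directed_semicontinuous False = lower_hausdorff_semicontinuous"
  by (simp_all add: fun_eq_iff directed_semicontinuous_def upper_hausdorff_semicontinuous_def
      lower_hausdorff_semicontinuous_def)

subsection \<open>Restricted centers of product sets\<close>

locale centered_family = normed_family +
  fixes Y :: "nat \<Rightarrow> 'a set"
  assumes Y_closed: "\<And>i. Y i \<in> CL (X i) (N i)" and Y_zero: "\<And>i. 0 \<in> Y i"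
    and rcp: "\<And>i. restricted_center_property (N i) (Y i) (CB (X i) (N i))"
begin

abbreviation "YY \<equiv> lp_sum p Y N"
abbreviation "Z i \<equiv> center_map (N i) (Y i)"

lemma Y_subset: "Y i \<subseteq> X i"
  using Y_closed by (simp add: CL_iff[OF normed])

lemma mem_YY_iff: "x \<in> YY \<longleftrightarrow> x \<in> XX \<and> (\<forall>i. x i \<in> Y i)"
  using Y_subset by (auto simp: lp_sum_def)

lemma Z_CB: "F \<in> CB (X i) (N i) \<Longrightarrow> Z i F \<in> CB (X i) (N i)"
  using rcp by (intro center_map_CB normed Y_closed Y_zero)
    (auto simp: restricted_center_property_def)

lemma Z_norm_le:
  "F \<in> CB (X i) (N i) \<Longrightarrow> v \<in> Z i F \<Longrightarrow> N i v \<le> 2 * far_radius (N i) 0 F"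
  by (rule center_norm_le[OF normed _ Y_subset Y_zero])

text \<open>The bounds \<open>2 * far_radius (N i) 0 (F i)\<close> form a sequence of finite
  \<open>p\<close>-norm. Nonemptiness is included, so families of coordinatewise centers do exist in
  the sum.\<close>

lemma product_centers_CB:
  assumes F: "\<And>i. F i \<in> CB (X i) (N i)" "Pi UNIV F \<in> CB XX NN"
  shows "Pi UNIV (\<lambda>i. Z i (F i)) \<in> CB XX NN"
  using p by (intro product_CB[OF Z_CB[OF F(1)] Z_norm_le[OF F(1)]
      lp_le_scale[OF _ lp_le_far_radius_0[OF F]]]) auto

text \<open>The \<open>p\<close>-th powers of the radii add up over the coordinates, so a family of
  coordinatewise minimizers is optimal. Conversely, two convergent series with termwise ordered
  terms and equal sums have equal terms.\<close>

lemma center_map_product: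
  assumes F: "\<And>i. F i \<in> CB (X i) (N i)" "Pi UNIV F \<in> CB XX NN"
  shows "center_map NN YY (Pi UNIV F) = Pi UNIV (\<lambda>i. Z i (F i))"
proof -
  define r where "r x i = far_radius (N i) (x i) (F i)" for x i
  have YX: "YY \<subseteq> XX" by (auto simp: mem_YY_iff)
  note ZZ = mem_center_map_iff[OF normed_space_lp_sum F(2) YX]
  note Zi = mem_center_map_iff[OF normed F(1) Y_subset]
  have mem: "x \<in> YY" if "x \<in> Pi UNIV (\<lambda>i. Z i (F i))" for x
  proof -
    have "x \<in> XX" using CB_D(2)[OF normed_space_lp_sum product_centers_CB[OF F]] that by blast
    then show ?thesis using that by (auto simp: mem_YY_iff Zi Pi_iff)
  qed
  have lp: "lp_le p (r x) C \<longleftrightarrow> 0 \<le> C \<and> far_radius NN x (Pi UNIV F) \<le> C" if "x \<in> YY" for x C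
    unfolding r_def using that YX by (intro far_radius_product_le_iff F) auto
  have nonneg: "0 \<le> r x i" if "x \<in> YY" for x i
    using that Y_subset unfolding r_def by (intro far_radius_nonneg[OF normed F(1)]) (auto simp: mem_YY_iff)
  have far_nonneg: "0 \<le> far_radius NN x (Pi UNIV F)" if "x \<in> YY" for x
    using that YX by (intro far_radius_nonneg[OF normed_space_lp_sum F(2)]) auto
  have le: "r x i \<le> r y i" if "x \<in> Pi UNIV (\<lambda>i. Z i (F i))" "y \<in> YY" for x y i
    using that by (auto simp: r_def Zi Pi_iff mem_YY_iff)
  show ?thesis
  proof
    show "Pi UNIV (\<lambda>i. Z i (F i)) \<subseteq> center_map NN YY (Pi UNIV F)"
    proof
      fix x assume x: "x \<in> Pi UNIV (\<lambda>i. Z i (F i))"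
      have "far_radius NN x (Pi UNIV F) \<le> far_radius NN y (Pi UNIV F)" if y: "y \<in> YY" for y
      proof -
        have "lp_le p (r y) (far_radius NN y (Pi UNIV F))"
          using lp[OF y] far_nonneg[OF y] by simp
        then have "lp_le p (r x) (far_radius NN y (Pi UNIV F))"
          using p nonneg[OF mem[OF x]] le[OF x y] by (auto intro: lp_le_mono)
        then show ?thesis using lp[OF mem[OF x]] by simp
      qed
      then show "x \<in> center_map NN YY (Pi UNIV F)" using mem[OF x] by (simp add: ZZ)
    qed
    show "center_map NN YY (Pi UNIV F) \<subseteq> Pi UNIV (\<lambda>i. Z i (F i))"
    proof
      fix x assume x: "x \<in> center_map NN YY (Pi UNIV F)"
      then have xY: "x \<in> YY" by (simp add: ZZ)
      txt \<open>Compared with a family \<open>w\<close> of coordinatewise centers, \<open>x\<close> is nowhere better, and its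
        series is not larger; hence both series agree termwise.\<close>
      obtain w where w: "w \<in> Pi UNIV (\<lambda>i. Z i (F i))"
        using CB_D(1)[OF normed_space_lp_sum product_centers_CB[OF F]] by blast
      note wY = mem[OF w]
      \<comment> \<open>\<open>C\<close> is the exact \<open>p\<close>-norm of the radii of
        \<open>w\<close>, so \<open>C powr p\<close> is their power sum. It bounds the radius of the
        product at \<open>w\<close>, hence also at the center \<open>x\<close>.\<close>
      define C where "C = (\<Sum>i. r w i powr p) powr (1 / p)"
      have "lp_le p (r w) (far_radius NN w (Pi UNIV F))"
        using lp[OF wY] far_nonneg[OF wY] by simp
      then have sw: "summable (\<lambda>i. r w i powr p)"
        using p lp_le_iff_suminf[OF _ nonneg[OF wY] far_nonneg[OF wY]] by simp
      then have "lp_le p (r w) C"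
        using p lp_le_iff_suminf[OF _ nonneg[OF wY], of p C] by (simp add: C_def)
      then have "far_radius NN w (Pi UNIV F) \<le> C" "0 \<le> C" using lp[OF wY] by auto
      then have "far_radius NN x (Pi UNIV F) \<le> C" using x wY by (auto simp: ZZ)
      then have "lp_le p (r x) C" using lp[OF xY] \<open>0 \<le> C\<close> by simp
      then have sx: "summable (\<lambda>i. r x i powr p)" and "(\<Sum>i. r x i powr p) powr (1 / p) \<le> C"
        using p lp_le_iff_suminf[OF _ nonneg[OF xY] \<open>0 \<le> C\<close>, of p] by auto
      then have "((\<Sum>i. r x i powr p) powr (1 / p)) powr p \<le> C powr p"
        using p by (intro powr_mono2) auto
      then have "(\<Sum>i. r x i powr p) \<le> (\<Sum>i. r w i powr p)"
        using p suminf_nonneg[OF sx] suminf_nonneg[OF sw] by (simp add: C_def powr_powr)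
      then have "(\<Sum>i. r x i powr p - r w i powr p) \<le> 0"
        using suminf_diff[OF sx sw] by simp
      moreover have diff: "0 \<le> r x i powr p - r w i powr p" for i
        using p nonneg[OF wY] le[OF w xY] by (simp add: powr_mono2)
      moreover have sd: "summable (\<lambda>i. r x i powr p - r w i powr p)"
        using sx sw by (rule summable_diff)
      ultimately have "\<forall>i. r x i powr p - r w i powr p = 0"
        using suminf_eq_zero_iff[OF sd diff] suminf_nonneg[OF sd diff] by simp
      then have "r x i = r w i" for i
        using p powr_less_mono2[of p "r w i" "r x i"] nonneg[OF wY, of i] le[OF w xY, of i]
        by fastforce
      then show "x \<in> Pi UNIV (\<lambda>i. Z i (F i))"
        using w xY by (auto simp: Zi Pi_iff r_def mem_YY_iff)
    qed
  qed
qed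

section \<open>Semi-continuity passes from the factors to the sum\<close>

lemma product_setsE:
  assumes "F \<in> product_sets p X N"
  obtains G where "F = Pi UNIV G" "\<And>i. G i \<in> CB (X i) (N i)" "Pi UNIV G \<in> CB XX NN"
  using assms by (auto simp: product_sets_def)

lemma product_setsI:
  "(\<And>i. G i \<in> CB (X i) (N i)) \<Longrightarrow> Pi UNIV G \<in> CB XX NN \<Longrightarrow> Pi UNIV G \<in> product_sets p X N"
  by (auto simp: product_sets_def)

lemma directed_semicontinuous_product:
  assumes Z: "\<And>i. directed_semicontinuous up (X i) (N i) (CB (X i) (N i))
    (hausdorff_metric (X i) (N i)) (Z i)"
  shows "directed_semicontinuous up XX NN (product_sets p X N) (hausdorff_metric XX NN)
    (center_map NN YY)"
  unfolding directed_semicontinuous_def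
proof (intro conjI ballI allI impI)
  show "center_map NN YY \<in> product_sets p X N \<rightarrow> CB XX NN"
    by (auto elim!: product_setsE simp: center_map_product product_centers_CB)
  fix F0 and e :: real assume F0: "F0 \<in> product_sets p X N" and e: "0 < e"
  obtain G where G: "F0 = Pi UNIV G" "\<And>i. G i \<in> CB (X i) (N i)" "Pi UNIV G \<in> CB XX NN"
    using product_setsE[OF F0] by metis
  \<comment> \<open>Each tail may cost \<open>e / 8\<close>, as it enters the final estimate
    doubled. Starting from \<open>e / 16\<close> leaves room for the increase by
    \<open>\<delta>\<close> at a neighbouring set.\<close>
  obtain n where n: "lp_le p (\<lambda>i. if i < n then 0 else far_radius (N i) 0 (G i)) (e / 16)"
    using lp_le_tail[OF p lp_le_far_radius_0[OF G(2,3)], of "e / 16"] e by auto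
  \<comment> \<open>Chosen so that \<open>n\<close> coordinates cost at most \<open>e / 4\<close>
    together; \<open>n + 1\<close> keeps the divisor nonzero when \<open>n = 0\<close>.\<close>
  define h where "h = e / (4 * (real n + 1))"
  have h: "0 < h" "real n * h \<le> e / 4" using e by (auto simp: h_def field_simps)
  have "\<exists>d>0. \<forall>A\<in>CB (X i) (N i). hausdorff_metric (X i) (N i) A (G i) < d \<longrightarrow>
      (if up then Z i A else Z i (G i)) \<subseteq> thicken (X i) (N i) h (if up then Z i (G i) else Z i A)" for i
    using Z[of i] G(2)[of i] h(1) unfolding directed_semicontinuous_def by blast
  then obtain d where d: "\<And>i. 0 < d i"
    "\<And>i A. A \<in> CB (X i) (N i) \<Longrightarrow> hausdorff_metric (X i) (N i) A (G i) < d i \<Longrightarrow>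
      (if up then Z i A else Z i (G i)) \<subseteq> thicken (X i) (N i) h (if up then Z i (G i) else Z i A)"
    by metis
  \<comment> \<open>Only finitely many of the \<open>d i\<close> matter, so their minimum is still
    positive. The entry \<open>e / 16\<close> controls the tail and keeps the set nonempty when
    \<open>n = 0\<close>.\<close>
  define \<delta> where "\<delta> = Min (insert (e / 16) (d ` {..<n}))"
  have \<delta>: "0 < \<delta>" "\<delta> \<le> e / 16" "\<And>i. i < n \<Longrightarrow> \<delta> \<le> d i"
  proof -
    show "0 < \<delta>" using e d(1) by (simp add: \<delta>_def)
    show "\<delta> \<le> e / 16" unfolding \<delta>_def by (rule Min_le) auto
    show "\<delta> \<le> d i" if "i < n" for i unfolding \<delta>_def using that by (intro Min_le) auto
  qed
  show "\<exists>\<delta>>0. \<forall>F\<in>product_sets p X N. hausdorff_metric XX NN F F0 < \<delta> \<longrightarrow>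
      (if up then center_map NN YY F else center_map NN YY F0)
      \<subseteq> thicken XX NN e (if up then center_map NN YY F0 else center_map NN YY F)"
  proof (intro exI[of _ \<delta>] conjI \<delta> ballI impI)
    fix F assume "F \<in> product_sets p X N" and less: "hausdorff_metric XX NN F F0 < \<delta>"
    then obtain K where K: "F = Pi UNIV K" "\<And>i. K i \<in> CB (X i) (N i)" "Pi UNIV K \<in> CB XX NN"
      using product_setsE by metis
    note less = less[unfolded K(1) G(1)]
    \<comment> \<open>The centers of \<open>A\<close> are to be approximated by those of
      \<open>B\<close>, so one estimate serves both kinds of semi-continuity.\<close>
    define A where "A = (if up then K else G)"
    define B where "B = (if up then G else K)"
    have CB: "A i \<in> CB (X i) (N i)" "B i \<in> CB (X i) (N i)" for i
      using K(2) G(2) by (auto simp: A_def B_def)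
    have PCB: "Pi UNIV A \<in> CB XX NN" "Pi UNIV B \<in> CB XX NN"
      using K(3) G(3) by (auto simp: A_def B_def)
    have mono: "lp_le p s (e / 8)" if "lp_le p s t" "t \<le> e / 8" for s t
      using p that lp_le_D(2)[OF that(1)] by (intro lp_le_mono[OF _ that(1)]) auto
    have "lp_le p (\<lambda>i. if i < n then 0 else far_radius (N i) 0 (K i)) (e / 8)"
      using mono[OF tail_far_radius_le[OF K(2,3) G(2,3) less n]] \<delta>(2) by simp
    moreover have "lp_le p (\<lambda>i. if i < n then 0 else far_radius (N i) 0 (G i)) (e / 8)"
      using mono[OF n] e by simp
    ultimately have tail: "lp_le p (\<lambda>i. if i < n then 0 else far_radius (N i) 0 (H i)) (e / 8)"
      if "H = K \<or> H = G" for H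
      using that by blast
    have tails: "lp_le p (\<lambda>i. if i < n then 0 else far_radius (N i) 0 (A i)) (e / 8)"
      "lp_le p (\<lambda>i. if i < n then 0 else far_radius (N i) 0 (B i)) (e / 8)"
      by (rule tail, simp add: A_def B_def)+
    have near: "\<exists>w\<in>Z i (B i). N i (v - w) \<le> h" if "i < n" "v \<in> Z i (A i)" for i v
    proof -
      have "hausdorff_metric (X i) (N i) (K i) (G i) < d i"
        using hausdorff_metric_component_less[OF K(2,3) G(2,3), of "d i" i] less \<delta>(3)[OF that(1)]
        by linarith
      then have "Z i (A i) \<subseteq> thicken (X i) (N i) h (Z i (B i))"
        using d(2)[OF K(2)[of i]] by (auto simp: A_def B_def split: if_splits)
      then show ?thesis
        using that(2) CB_D(2)[OF normed Z_CB[OF CB(1)]] CB_D(2)[OF normed Z_CB[OF CB(2)]] h(1)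
        by (simp add: subset_thicken_iff[OF normed])
    qed
    have "Pi UNIV (\<lambda>i. Z i (A i)) \<subseteq> thicken XX NN e (Pi UNIV (\<lambda>i. Z i (B i)))"
      unfolding subset_thicken_iff[OF normed_space_lp_sum
          CB_D(2)[OF normed_space_lp_sum product_centers_CB[OF CB(1) PCB(1)]]
          CB_D(2)[OF normed_space_lp_sum product_centers_CB[OF CB(2) PCB(2)]] e]
    proof
      fix u assume u: "u \<in> Pi UNIV (\<lambda>i. Z i (A i))"
      \<comment> \<open>Beyond \<open>n\<close> any center will do, since the tails absorb its
        distance from \<open>u i\<close>.\<close>
      have "\<exists>w\<in>Z i (B i). i < n \<longrightarrow> N i (u i - w) \<le> h" for i
      proof (cases "i < n")
        case True
        then show ?thesis using near[of i "u i"] u by auto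
      next
        case False
        then show ?thesis using CB_D(1)[OF normed Z_CB[OF CB(2)]] by auto
      qed
      then obtain w where w: "\<And>i. w i \<in> Z i (B i)" "\<And>i. i < n \<Longrightarrow> N i (u i - w i) \<le> h"
        by metis
      have uZ: "u i \<in> Z i (A i)" for i using u by auto
      have "NN (u - w) \<le> real n * h + 2 * (e / 8) + 2 * (e / 8)"
      proof (rule norm_diff_le_head_tail)
        show "u i \<in> X i" "w i \<in> X i" for i
          using uZ w(1) CB_D(2)[OF normed Z_CB[OF CB(1)]] CB_D(2)[OF normed Z_CB[OF CB(2)]]
          by blast+
        show "N i (u i) \<le> 2 * far_radius (N i) 0 (A i)" "N i (w i) \<le> 2 * far_radius (N i) 0 (B i)"
          for i using Z_norm_le[OF CB(1) uZ] Z_norm_le[OF CB(2) w(1)] .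
      qed (use w(2) h(1) tails in auto)
      also have "\<dots> \<le> e" using h(2) e by simp
      finally show "\<exists>w\<in>Pi UNIV (\<lambda>i. Z i (B i)). NN (u - w) \<le> e"
        using w(1) by (intro bexI[of _ w]) auto
    qed
    then show "(if up then center_map NN YY F else center_map NN YY F0)
        \<subseteq> thicken XX NN e (if up then center_map NN YY F0 else center_map NN YY F)"
      by (auto simp: A_def B_def K(1) G(1) center_map_product K(2,3) G(2,3) split: if_splits)
  qed
qed

section \<open>Semi-continuity passes from the sum to each factor\<close>

definition embed_factor :: "nat \<Rightarrow> 'a set \<Rightarrow> nat \<Rightarrow> 'a set"
  where "embed_factor i A = (\<lambda>_. {0})(i := A)"

lemma embed_factor_CB:
  assumes A: "A \<in> CB (X i) (N i)"
  shows "embed_factor i A j \<in> CB (X j) (N j)" "Pi UNIV (embed_factor i A) \<in> CB XX NN"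
proof -
  show CB: "embed_factor i A j \<in> CB (X j) (N j)" for j
    using A CB_singleton_0[OF normed] by (simp add: embed_factor_def)
  obtain B where B: "\<And>a. a \<in> A \<Longrightarrow> N i a \<le> B" using CB_bounded[OF normed A] by blast
  have B0: "0 \<le> B"
    using CB_D(1,2)[OF normed A] B normed_space_onD(4)[OF normed]
    by (metis all_not_in_conv order_trans subsetD)
  show "Pi UNIV (embed_factor i A) \<in> CB XX NN"
    by (rule product_CB[OF CB _ lp_le_single[OF B0, of p i]])
      (use B p normed_space_onD(3)[OF normed] in \<open>auto simp: embed_factor_def split: if_splits\<close>)
qed

text \<open>Points of embedded sets vanish off coordinate \<open>i\<close>, so an approximant in the
  factor is copied into that coordinate and the difference has a single nonzero entry.\<close>

lemma hausdorff_metric_embed_factor_less: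
  assumes A: "A \<in> CB (X i) (N i)" and B: "B \<in> CB (X i) (N i)"
    and less: "hausdorff_metric (X i) (N i) A B < d"
  shows "hausdorff_metric XX NN (Pi UNIV (embed_factor i A)) (Pi UNIV (embed_factor i B)) < d"
proof -
  obtain r where r: "0 < r" "r < d"
    "\<And>a. a \<in> A \<Longrightarrow> \<exists>b\<in>B. N i (a - b) \<le> r" "\<And>b. b \<in> B \<Longrightarrow> \<exists>a\<in>A. N i (b - a) \<le> r"
    using hausdorff_metric_lessE[OF normed A B less] by metis
  have *: "\<exists>g\<in>Pi UNIV (embed_factor i B). NN (f - g) \<le> r"
    if f: "f \<in> Pi UNIV (embed_factor i A)" and A: "A \<in> CB (X i) (N i)" and B: "B \<in> CB (X i) (N i)"
      and AB: "\<And>a. a \<in> A \<Longrightarrow> \<exists>b\<in>B. N i (a - b) \<le> r" for A B f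
  proof -
    have fi: "f i \<in> A" "\<And>j. j \<noteq> i \<Longrightarrow> f j = 0"
      using f by (auto simp: embed_factor_def Pi_iff split: if_splits)
    then obtain b where b: "b \<in> B" "N i (f i - b) \<le> r" using AB by blast
    define g where "g = f(i := b)"
    have g: "g \<in> Pi UNIV (embed_factor i B)"
      using b(1) fi by (auto simp: g_def embed_factor_def)
    have "f - g \<in> XX"
      using f g CB_D(2)[OF normed_space_lp_sum embed_factor_CB(2)[OF A]]
        CB_D(2)[OF normed_space_lp_sum embed_factor_CB(2)[OF B]]
      by (intro normed_space_onD(8)[OF normed_space_lp_sum]) auto
    then have X: "(f - g) j \<in> X j" for j by (rule lp_sum_component)
    have "lp_le p (\<lambda>j. N j ((f - g) j)) r"
      by (rule lp_le_mono[OF _ lp_le_single[of r p i]])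
        (use r(1) p b(2) normed_space_onD(4)[OF normed X] normed_space_onD(3)[OF normed]
          in \<open>auto simp: g_def\<close>)
    then have "NN (f - g) \<le> r" using lp_le_norm_iff[OF X] by blast
    then show ?thesis using g by blast
  qed
  have "hausdorff_metric XX NN (Pi UNIV (embed_factor i A)) (Pi UNIV (embed_factor i B)) \<le> r"
    using *[OF _ A B r(3)] *[OF _ B A r(4)] r(1)
    by (intro hausdorff_metric_le normed_space_lp_sum CB_D(2)[OF normed_space_lp_sum]
        embed_factor_CB A B)
  then show ?thesis using r(2) by simp
qed

text \<open>The \<open>d\<close> found for the embedded sets works unchanged for the factor. A
  center of the factor is lifted to the sum, approximated there, and the approximant is projected
  back.\<close>

lemma directed_semicontinuous_factor:
  assumes ZZ: "directed_semicontinuous up XX NN (product_sets p X N) (hausdorff_metric XX NN)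
    (center_map NN YY)"
  shows "directed_semicontinuous up (X i) (N i) (CB (X i) (N i))
    (hausdorff_metric (X i) (N i)) (Z i)"
  unfolding directed_semicontinuous_def
proof (intro conjI ballI allI impI)
  show "Z i \<in> CB (X i) (N i) \<rightarrow> CB (X i) (N i)" using Z_CB by blast
  let ?E = "\<lambda>A. Pi UNIV (embed_factor i A)"
  fix A0 and e :: real assume A0: "A0 \<in> CB (X i) (N i)" and e: "0 < e"
  have "?E A0 \<in> product_sets p X N" using embed_factor_CB[OF A0] by (rule product_setsI)
  then obtain d where d: "0 < d" "\<And>F. F \<in> product_sets p X N \<Longrightarrow> hausdorff_metric XX NN F (?E A0) < d \<Longrightarrow>
      (if up then center_map NN YY F else center_map NN YY (?E A0))
      \<subseteq> thicken XX NN e (if up then center_map NN YY (?E A0) else center_map NN YY F)"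
    using ZZ e unfolding directed_semicontinuous_def by meson
  show "\<exists>\<delta>>0. \<forall>A\<in>CB (X i) (N i). hausdorff_metric (X i) (N i) A A0 < \<delta> \<longrightarrow>
      (if up then Z i A else Z i A0) \<subseteq> thicken (X i) (N i) e (if up then Z i A0 else Z i A)"
  proof (intro exI[of _ d] conjI d(1) ballI impI)
    fix A assume A: "A \<in> CB (X i) (N i)" and less: "hausdorff_metric (X i) (N i) A A0 < d"
    define B where "B = (if up then A else A0)"
    define C where "C = (if up then A0 else A)"
    have B: "B \<in> CB (X i) (N i)" and C: "C \<in> CB (X i) (N i)"
      using A A0 by (auto simp: B_def C_def)
    note sub = CB_D(2)[OF normed_space_lp_sum product_centers_CB[OF embed_factor_CB]]
    have "?E A \<in> product_sets p X N" using embed_factor_CB[OF A] by (rule product_setsI)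
    from d(2)[OF this hausdorff_metric_embed_factor_less[OF A A0 less]]
    have "center_map NN YY (?E B) \<subseteq> thicken XX NN e (center_map NN YY (?E C))"
      by (auto simp: B_def C_def split: if_splits)
    then have near: "\<exists>w\<in>Pi UNIV (\<lambda>j. Z j (embed_factor i C j)). NN (u - w) \<le> e"
      if "u \<in> Pi UNIV (\<lambda>j. Z j (embed_factor i B j))" for u
      using that
      by (simp add: center_map_product embed_factor_CB B C
          subset_thicken_iff[OF normed_space_lp_sum sub[OF B B] sub[OF C C] e])
    have "\<exists>w\<in>Z i C. N i (v - w) \<le> e" if v: "v \<in> Z i B" for v
    proof -
      \<comment> \<open>Off coordinate \<open>i\<close> the embedded set has the factor
        \<open>{0}\<close>, of which 0 is a center; hence \<open>u\<close> is a center of the whole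
        product.\<close>
      define u where "u = (\<lambda>_. 0)(i := v)"
      have u: "u \<in> Pi UNIV (\<lambda>j. Z j (embed_factor i B j))"
        using v center_map_singleton_0[OF normed Y_subset Y_zero]
        by (auto simp: u_def embed_factor_def)
      then obtain w where w: "w \<in> Pi UNIV (\<lambda>j. Z j (embed_factor i C j))" "NN (u - w) \<le> e"
        using near by blast
      have "u - w \<in> XX"
        using u w(1) sub[OF B B] sub[OF C C]
        by (intro normed_space_onD(8)[OF normed_space_lp_sum]) auto
      from norm_component_le[OF this, of i] have "N i (v - w i) \<le> e"
        using w(2) by (simp add: u_def)
      moreover have "w i \<in> Z i C" using w(1) by (auto simp: embed_factor_def Pi_iff dest: spec[of _ i])
      ultimately show ?thesis by blast
    qed
    then have "Z i B \<subseteq> thicken (X i) (N i) e (Z i C)"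
      using subset_thicken_iff[OF normed CB_D(2)[OF normed Z_CB[OF B]] CB_D(2)[OF normed Z_CB[OF C]] e]
      by blast
    then show "(if up then Z i A else Z i A0) \<subseteq> thicken (X i) (N i) e (if up then Z i A0 else Z i A)"
      by (auto simp: B_def C_def split: if_splits)
  qed
qed

end

theorem theorem3p18:
  fixes X Y :: "nat \<Rightarrow> 'a::real_vector set"
    and N :: "nat \<Rightarrow> 'a \<Rightarrow> real"
    and p :: real
  assumes banach: "\<And>i. banach_space_on (X i) (N i)"
    and closed_subspace: "\<And>i. subspace (Y i) \<and> Y i \<in> CL (X i) (N i)"
    and rcp: "\<And>i. restricted_center_property (N i) (Y i) (CB (X i) (N i))"
    and p: "1 \<le> p"
  defines "XX \<equiv> lp_sum p X N"
    and "YY \<equiv> lp_sum p Y N"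
    and "NN \<equiv> lp_norm p N"
  shows
    "((\<forall>i. lower_hausdorff_semicontinuous (X i) (N i)
            (CB (X i) (N i)) (hausdorff_metric (X i) (N i)) (center_map (N i) (Y i)))
      \<longleftrightarrow> lower_hausdorff_semicontinuous XX NN
            (product_sets p X N) (hausdorff_metric XX NN) (center_map NN YY))
     \<and>
     ((\<forall>i. upper_hausdorff_semicontinuous (X i) (N i)
            (CB (X i) (N i)) (hausdorff_metric (X i) (N i)) (center_map (N i) (Y i)))
      \<longleftrightarrow> upper_hausdorff_semicontinuous XX NN
            (product_sets p X N) (hausdorff_metric XX NN) (center_map NN YY))"
proof -
  interpret centered_family X N p Y
    using banach closed_subspace rcp p by unfold_locales (auto simp: banach_space_on_def subspace_0)
  have "(\<forall>i. directed_semicontinuous up (X i) (N i)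
            (CB (X i) (N i)) (hausdorff_metric (X i) (N i)) (center_map (N i) (Y i)))
      \<longleftrightarrow> directed_semicontinuous up XX NN
            (product_sets p X N) (hausdorff_metric XX NN) (center_map NN YY)" for up
    unfolding XX_def YY_def NN_def
    using directed_semicontinuous_product directed_semicontinuous_factor by blast
  from this[of False] this[of True] show ?thesis
    by (simp add: directed_semicontinuous_simps)
qed

end
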